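(* Let $a(s)=s^4+a_1s^3+a_2s^2+a_3s+a_4$ and $b(s)=s^4+b_1s^3+b_2s^2+b_3s+b_4$ be real polynomials that are the endpoints of a stable polynomial segment, i.e. $\lambda b(s)+(1-\lambda)a(s)$ is Hurwitz stable for every $\lambda\in[0,1]$. Then there exists a fixed real polynomial $c(s)$ such that $c(s)/a(s)$ and $c(s)/b(s)$ are both strictly positive real.
   Context: A real polynomial is Hurwitz stable if all its complex roots have negative real part. A rational function $f(s)=p(s)/q(s)$, with $p,q$ real polynomials, that is biproper (i.e. $\deg p=\deg q$) is called strictly positive real (SPR) if (i) $f$ is analytic in $\mathrm{Re}[s]\ge 0$, i.e. $q$ is Hurwitz stable; and (ii) $\mathrm{Re}[f(j\omega)]>0$ for all $\omega\in\mathbb{R}$, where $j=\sqrt{-1}$. (In particular, strict positive realness of $c/a$ includes the requirement $\deg c=\deg a$.) *)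

theory Defs
  imports Complex_Main "HOL-Computational_Algebra.Polynomial"
begin

(* The zero polynomial vanishes everywhere, so it is not Hurwitz stable. *)
definition hurwitz_stable :: "real poly \<Rightarrow> bool" where
  "hurwitz_stable p \<longleftrightarrow> (\<forall>z. poly (map_poly complex_of_real p) z = 0 \<longrightarrow> Re z < 0)"

(* The rational function p/q is given by its numerator p and denominator q.
   Its analyticity in Re s >= 0 is read as Hurwitz stability of q; this also makes
   q nonzero on the imaginary axis, so the quotient below is never a division by 0. *)
definition strictly_positive_real :: "real poly \<Rightarrow> real poly \<Rightarrow> bool" where
  "strictly_positive_real p q \<longleftrightarrow>
     degree p = degree q \<and>
     hurwitz_stable q \<and>
     (\<forall>\<omega>::real. Re (poly (map_poly complex_of_real p) (\<i> * complex_of_real \<omega>) /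
                    poly (map_poly complex_of_real q) (\<i> * complex_of_real \<omega>)) > 0)"

end

theory Submission
  imports Defs "HOL-Analysis.Convex_Euclidean_Space"
    "HOL-Computational_Algebra.Fundamental_Theorem_Algebra"
begin

text \<open>
The numerator is sought in the form \<open>c = e s\<^sup>4 + X s\<^sup>3 + s\<^sup>2 + Y s + e\<close> with a small \<open>e > 0\<close>. Write
\<open>a(\<i> w) = A\<^sub>e(x) + \<i> w A\<^sub>o(x)\<close> with \<open>x = w\<^sup>2\<close>, so that \<open>A\<^sub>e\<close> is a monic quadratic and \<open>A\<^sub>o\<close> is
affine with root \<open>\<alpha>\<close>. For \<open>e = 0\<close> the real part of \<open>c / a\<close> has the sign of
\<open>x (A\<^sub>o(x) (Y - x X) - A\<^sub>e(x))\<close>. If the second factor is at least \<open>d (1 + x\<^sup>2)\<close> for some \<open>d > 0\<close>, a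
small \<open>e\<close> turns this into strict positivity for all \<open>x \<ge> 0\<close> and gives \<open>c\<close> degree four
(\<open>spr_region_imp_spr\<close>). So it suffices to find a point \<open>(X, Y)\<close> common to two regions of the
plane, one for \<open>a\<close> and one for \<open>b\<close>.

Each region is an intersection of half planes, hence convex. It is the inside of a parabola whose
axis has slope \<open>\<alpha>\<close> and whose tangent of slope \<open>x \<noteq> \<alpha>\<close> is the line
\<open>Y - x X = A\<^sub>e(x) / A\<^sub>o(x)\<close>; it is nonempty because \<open>A\<^sub>e(\<alpha>) < 0\<close>, which is the Routh-Hurwitz
condition for \<open>a\<close>. Suppose that the regions of \<open>a\<close> and \<open>b\<close> are disjoint, and separate them by a
line. A half plane that contains a parabola contains the direction of its axis in its interior
(\<open>spr_region_halfplane_axis\<close>), so the slope \<open>x\<close> of the line lies strictly between the roots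
\<open>\<alpha>\<close> of \<open>A\<^sub>o\<close> and \<open>\<beta>\<close> of \<open>B\<^sub>o\<close>. The line also separates the two tangents of slope \<open>x\<close>
(\<open>spr_region_halfplane_tangent\<close>), which orders \<open>A\<^sub>e(x) / A\<^sub>o(x)\<close> and \<open>B\<^sub>e(x) / B\<^sub>o(x)\<close>. Near
\<open>\<alpha>\<close>, between the roots, the order is the opposite one, because \<open>A\<^sub>e(\<alpha>) < 0\<close>. Hence the two quotients agree at some
point \<open>y\<close> strictly between the roots, where \<open>A\<^sub>o\<close> and \<open>B\<^sub>o\<close> have opposite signs. Then
\<open>a(\<i> w)\<close> and \<open>b(\<i> w)\<close>, with \<open>w\<^sup>2 = y\<close>, point in opposite directions, and some polynomial of the
segment vanishes at \<open>\<i> w\<close>, against stability (\<open>stable_segment_not_antiparallel\<close>).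
\<close>

section \<open>Real polynomials at complex points and their quadratic factors\<close>

abbreviation ceval :: "real poly \<Rightarrow> complex \<Rightarrow> complex" where
  "ceval p z \<equiv> poly (map_poly complex_of_real p) z"

lemma ceval_pCons: "ceval (pCons c p) z = of_real c + z * ceval p z"
  by (simp add: map_poly_pCons)

lemma ceval_add: "ceval (p + q) z = ceval p z + ceval q z"
proof -
  have "map_poly complex_of_real (p + q) = map_poly complex_of_real p + map_poly complex_of_real q"
    by (rule poly_eqI) (simp add: coeff_map_poly)
  then show ?thesis by simp
qed

lemma ceval_smult: "ceval (smult c p) z = of_real c * ceval p z"
  by (induction p) (simp_all add: ceval_pCons algebra_simps)

lemma ceval_mult: "ceval (p * q) z = ceval p z * ceval q z"
  by (induction p) (simp_all add: ceval_pCons ceval_add ceval_smult algebra_simps)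

lemma ceval_of_real: "ceval p (of_real x) = of_real (poly p x)"
  by (induction p) (simp_all add: ceval_pCons)

lemma ceval_has_root:
  assumes "degree p > 0"
  shows "\<exists>z. ceval p z = 0"
proof -
  have "degree (map_poly complex_of_real p) > 0"
    using assms by (subst degree_map_poly) auto
  then show ?thesis
    using fundamental_theorem_of_algebra constant_degree by (metis less_numeral_extra(3))
qed

text \<open>The remainder modulo the quadratic is a real polynomial of degree at most one with a
nonreal root, so it is zero.\<close>

lemma conjugate_pair_factor_dvd:
  assumes root: "ceval p z = 0" and nonreal: "Im z \<noteq> 0"
  shows "[:(cmod z)\<^sup>2, - 2 * Re z, 1:] dvd p"
proof -
  let ?q = "[:(cmod z)\<^sup>2, - 2 * Re z, 1:]"
  define r where "r = p mod ?q"
  have "(cmod z)\<^sup>2 = Re z * Re z + Im z * Im z"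
    unfolding cmod_power2 by (simp add: power2_eq_square)
  then have q0: "ceval ?q z = 0"
    by (simp add: ceval_pCons complex_eq_iff algebra_simps)
  have "p = ?q * (p div ?q) + r" by (metis r_def mult_div_mod_eq)
  then have "ceval p z = ceval ?q z * ceval (p div ?q) z + ceval r z"
    by (metis ceval_add ceval_mult)
  then have rz: "ceval r z = 0" using root q0 by simp
  have "degree r < 2"
    using degree_mod_less[of ?q p] by (auto simp: r_def)
  moreover obtain c r' where r': "r = pCons c r'" by (cases r)
  ultimately have "degree r' = 0" by (simp split: if_splits)
  then obtain d where r: "r = [:c, d:]" using r' by (auto elim: degree_eq_zeroE)
  have "d * Im z = 0" and "c + Re z * d = 0"
    using rz by (auto simp: r ceval_pCons complex_eq_iff mult.commute)
  then have "r = 0" using nonreal r by simp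
  then show ?thesis by (simp add: r_def dvd_eq_mod_eq_0)
qed

text \<open>A nonreal root contributes the quadratic of its conjugate pair; if all roots are real,
two linear factors can be split off and multiplied.\<close>

lemma real_poly_quadratic_factor:
  assumes deg: "degree p \<ge> 2"
  shows "\<exists>m n. [:n, m, 1:] dvd (p :: real poly)"
proof (cases "\<exists>z. ceval p z = 0 \<and> Im z \<noteq> 0")
  case True
  then show ?thesis using conjugate_pair_factor_dvd by blast
next
  case False
  have real_root: "\<exists>r. [:-r, 1:] dvd g" if g: "g dvd p" "degree g > 0" for g
  proof -
    obtain z where z: "ceval g z = 0" using ceval_has_root g(2) by blast
    then have "ceval p z = 0" using g(1) by (auto simp: dvd_def ceval_mult)
    then have "z = of_real (Re z)" using False by (auto simp: complex_eq_iff)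
    then have "poly g (Re z) = 0" using z by (metis ceval_of_real of_real_eq_0_iff)
    then show ?thesis using poly_eq_0_iff_dvd by blast
  qed
  obtain r g where g: "p = [:-r, 1:] * g"
    using real_root[of p] deg by (auto simp: dvd_def)
  then have "g \<noteq> 0" using deg by auto
  then have "degree g > 0" using g deg by (simp add: degree_mult_eq del: mult_pCons_left)
  then obtain s where "[:-s, 1:] dvd g" using real_root[of g] g by (meson dvd_triv_right)
  then have "[:-r, 1:] * [:-s, 1:] dvd p" unfolding g by (rule mult_dvd_mono[OF dvd_refl])
  then show ?thesis by auto
qed

lemma hurwitz_stable_factor:
  assumes "hurwitz_stable p" "q dvd p"
  shows "hurwitz_stable q"
  using assms by (auto simp: hurwitz_stable_def dvd_def ceval_mult)

text \<open>A root of largest real part, written out by the quadratic formula, already forces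
both signs.\<close>

lemma hurwitz_stable_quadratic:
  assumes "hurwitz_stable [:n, m, 1:]"
  shows "m > 0" and "n > 0"
proof -
  have stable: "Re z < 0" if "z\<^sup>2 + of_real m * z + of_real n = 0" for z :: complex
    using assms that by (auto simp: hurwitz_stable_def ceval_pCons power2_eq_square algebra_simps)
  have "m > 0 \<and> n > 0"
  proof (cases "m\<^sup>2 < 4 * n")
    case True
    define w where "w = sqrt (4 * n - m\<^sup>2)"
    have w2: "w * w = 4 * n - m * m" using True by (simp add: w_def power2_eq_square)
    have "Re (Complex (- m / 2) (w / 2)) < 0"
      by (rule stable) (simp add: complex_eq_iff power2_eq_square w2 field_simps)
    moreover have "n > 0" using True zero_le_power2[of m] by linarith
    ultimately show ?thesis by simp
  next
    case False
    define w where "w = sqrt (m\<^sup>2 - 4 * n)"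
    have w2: "w * w = m * m - 4 * n" and w0: "w \<ge> 0"
      using False by (simp_all add: w_def power2_eq_square)
    have "((w - m) / 2)\<^sup>2 + m * ((w - m) / 2) + n = 0"
      by (simp add: power_divide power2_diff field_simps) (use w2 in \<open>simp add: power2_eq_square\<close>)
    then have "Re (complex_of_real ((w - m) / 2)) < 0"
      by (intro stable) (metis of_real_0 of_real_add of_real_mult of_real_power)
    then have "w < m" by simp
    then have "w * w < m * m" using w0 by (intro mult_strict_mono) auto
    then show ?thesis using \<open>w < m\<close> w0 w2 by auto
  qed
  then show "m > 0" "n > 0" by auto
qed

section \<open>Stable quartics on the imaginary axis\<close>

text \<open>Along the imaginary axis \<^term>\<open>z = \<i> * of_real w\<close>, with \<open>x = w\<^sup>2\<close>, the monic quartic with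
coefficients \<open>a1, a2, a3, a4\<close> takes the value \<open>E x + \<i> w O x\<close>, where \<open>E\<close> and \<open>O\<close> are the following
two functions. The root \<open>a3 / a1\<close> of \<open>O\<close> is the point at which the value is real again; for a
stable quartic it is negative there.\<close>

definition even_part :: "real \<Rightarrow> real \<Rightarrow> real \<Rightarrow> real" where
  "even_part a2 a4 x = x\<^sup>2 - a2 * x + a4"

definition odd_part :: "real \<Rightarrow> real \<Rightarrow> real \<Rightarrow> real" where
  "odd_part a1 a3 x = a3 - a1 * x"

text \<open>The necessary half of the Routh-Hurwitz criterion. Splitting the quartic into two stable
quadratics makes every coefficient a positive expression, and the Hurwitz determinant
\<open>a1 a2 a3 - a3\<^sup>2 - a1\<^sup>2 a4\<close> factors into visibly positive terms.\<close>

lemma hurwitz_stable_quartic: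
  assumes stable: "hurwitz_stable [:a4, a3, a2, a1, 1:]"
  shows "a1 > 0" "a3 > 0" "a4 > 0" "even_part a2 a4 (a3 / a1) < 0"
proof -
  let ?p = "[:a4, a3, a2, a1, 1:]"
  obtain m n where mn: "[:n, m, 1:] dvd ?p"
    using real_poly_quadratic_factor[of ?p] by auto
  then obtain g where g: "?p = [:n, m, 1:] * g" by (auto simp: dvd_def)
  then have "g \<noteq> 0" by auto
  then have "degree ?p = 2 + degree g"
    unfolding g by (subst degree_mult_eq) auto
  then have "degree g = 2" by simp
  then obtain l k c where g2: "g = [:l, k, c:]"
    by (metis (no_types) degree_eq_zeroE degree_pCons_eq_if nat.inject numeral_2_eq_2 pCons_cases Zero_not_Suc)
  have c: "c = 1" using g by (simp add: g2)
  have coeffs: "a4 = n * l" "a3 = n * k + m * l" "a2 = n + m * k + l" "a1 = k + m"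
    using g by (simp_all add: g2 c algebra_simps)
  have "m > 0" "n > 0"
    using hurwitz_stable_quadratic hurwitz_stable_factor[OF stable mn] by auto
  moreover have "g dvd ?p" by (metis g dvd_triv_right)
  then have "hurwitz_stable [:l, k, 1:]"
    using hurwitz_stable_factor[OF stable, of g] by (simp add: g2 c)
  then have "k > 0" "l > 0" by (rule hurwitz_stable_quadratic)+
  ultimately have pos: "m > 0" "n > 0" "k > 0" "l > 0" by auto
  then show a: "a1 > 0" "a3 > 0" "a4 > 0" by (auto simp: coeffs add_pos_pos)
  have "a1\<^sup>2 * even_part a2 a4 (a3 / a1) = a3\<^sup>2 - a1 * a2 * a3 + a1\<^sup>2 * a4"
    using a by (simp add: even_part_def field_simps power2_eq_square)
  also have "\<dots> = - (m * k * ((n - l)\<^sup>2 + a1 * a3))"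
    by (simp add: coeffs power2_eq_square algebra_simps)
  also have "\<dots> < 0"
    using pos a by (simp add: add_nonneg_pos)
  finally show "even_part a2 a4 (a3 / a1) < 0"
    using a by (simp add: mult_less_0_iff)
qed

lemma ceval_imag_axis:
  "ceval [:p4, p3, p2, p1, p0:] (\<i> * of_real w)
    = Complex (p0 * w^4 - p2 * w\<^sup>2 + p4) (w * (p3 - p1 * w\<^sup>2))"
  by (simp add: ceval_pCons complex_eq_iff power2_eq_square power4_eq_xxxx algebra_simps)

text \<open>Equality would make the values of the two end polynomials at \<open>\<i> sqrt y\<close> negative multiples
of each other. The weight that cancels the odd parts then cancels the even parts as well, and the
corresponding member of the segment has a root on the imaginary axis.\<close>

lemma stable_segment_not_antiparallel:
  assumes seg: "\<forall>t\<in>{0..1::real}. hurwitz_stable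
      (smult t [:b4, b3, b2, b1, 1:] + smult (1 - t) [:a4, a3, a2, a1, 1:])"
    and y: "y \<ge> 0" and opp: "odd_part a1 a3 y * odd_part b1 b3 y < 0"
  shows "even_part a2 a4 y * odd_part b1 b3 y \<noteq> even_part b2 b4 y * odd_part a1 a3 y"
proof
  let ?A = "odd_part a1 a3 y" and ?B = "odd_part b1 b3 y"
  assume eq: "even_part a2 a4 y * ?B = even_part b2 b4 y * ?A"
  have ne: "?A - ?B \<noteq> 0" using opp by (auto simp: not_sum_power2_lt_zero mult_less_0_iff)
  define t where "t = ?A / (?A - ?B)"
  have t: "t \<in> {0..1}" using opp by (auto simp: t_def mult_less_0_iff field_simps)
  have t1: "1 - t = - ?B / (?A - ?B)" using ne by (simp add: t_def field_simps)
  have od: "t * ?B + (1 - t) * ?A = 0" unfolding t1 by (simp add: t_def)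
  have "t * even_part b2 b4 y + (1 - t) * even_part a2 a4 y
      = (even_part b2 b4 y * ?A - even_part a2 a4 y * ?B) / (?A - ?B)"
    unfolding t1 by (simp add: t_def diff_divide_distrib mult.commute)
  then have ev: "t * even_part b2 b4 y + (1 - t) * even_part a2 a4 y = 0" using eq by simp
  have "smult t [:b4, b3, b2, b1, 1:] + smult (1 - t) [:a4, a3, a2, a1, 1:]
     = [:t * b4 + (1 - t) * a4, t * b3 + (1 - t) * a3, t * b2 + (1 - t) * a2, t * b1 + (1 - t) * a1, 1:]"
    by simp
  moreover have "ceval \<dots> (\<i> * of_real (sqrt y)) = 0"
  proof -
    have s: "(sqrt y)^4 = y\<^sup>2" using y by (simp add: power4_eq_xxxx power2_eq_square)
    have "1 * (sqrt y)^4 - (t * b2 + (1 - t) * a2) * (sqrt y)\<^sup>2 + (t * b4 + (1 - t) * a4) = 0"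
      using ev y by (simp add: s even_part_def algebra_simps)
    moreover have "(t * b3 + (1 - t) * a3) - (t * b1 + (1 - t) * a1) * (sqrt y)\<^sup>2 = 0"
      using od y by (simp add: odd_part_def algebra_simps)
    ultimately show ?thesis unfolding ceval_imag_axis by (simp add: zero_complex.code)
  qed
  ultimately have "Re (\<i> * complex_of_real (sqrt y)) < 0"
    using seg t unfolding hurwitz_stable_def by metis
  then show False by simp
qed

section \<open>The region of admissible numerators\<close>

text \<open>The points \<open>(X, Y)\<close> for which \<open>X s\<^sup>3 + s\<^sup>2 + Y s\<close> over the quartic has positive real
part on the imaginary axis away from \<open>0\<close>. The margin \<open>d (1 + x\<^sup>2)\<close>, rather than plain positivity, also controls the
limits \<open>x = 0\<close> and \<open>x \<rightarrow> \<infinity>\<close>, where the numerator still has to be perturbed.\<close>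

definition spr_region :: "real \<Rightarrow> real \<Rightarrow> real \<Rightarrow> real \<Rightarrow> (real \<times> real) set" where
  "spr_region a1 a2 a3 a4 = {(X, Y). \<exists>d>0. \<forall>x\<ge>0.
     d * (1 + x\<^sup>2) \<le> odd_part a1 a3 x * (Y - x * X) - even_part a2 a4 x}"

lemma convex_spr_region: "convex (spr_region a1 a2 a3 a4)"
proof (rule convexI)
  fix P Q :: "real \<times> real" and u v :: real
  assume PQ: "P \<in> spr_region a1 a2 a3 a4" "Q \<in> spr_region a1 a2 a3 a4"
    and uv: "0 \<le> u" "0 \<le> v" "u + v = 1"
  obtain X Y X' Y' where P: "P = (X, Y)" and Q: "Q = (X', Y')" by (metis surj_pair)
  let ?f = "\<lambda>x X Y. odd_part a1 a3 x * (Y - x * X) - even_part a2 a4 x"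
  obtain d d' where d: "d > 0" "\<And>x. x \<ge> 0 \<Longrightarrow> d * (1 + x\<^sup>2) \<le> ?f x X Y"
    and d': "d' > 0" "\<And>x. x \<ge> 0 \<Longrightarrow> d' * (1 + x\<^sup>2) \<le> ?f x X' Y'"
    using PQ by (auto simp: spr_region_def P Q)
  have "(u * d + v * d') * (1 + x\<^sup>2) \<le> ?f x (u * X + v * X') (u * Y + v * Y')" if "x \<ge> 0" for x
  proof -
    have v: "v = 1 - u" using uv by simp
    have "(u * d + v * d') * (1 + x\<^sup>2) = u * (d * (1 + x\<^sup>2)) + v * (d' * (1 + x\<^sup>2))"
      by (simp add: algebra_simps)
    also have "\<dots> \<le> u * ?f x X Y + v * ?f x X' Y'"
      using uv d(2)[OF that] d'(2)[OF that] by (intro add_mono mult_left_mono) auto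
    also have "\<dots> = ?f x (u * X + v * X') (u * Y + v * Y')"
      unfolding v by (simp add: algebra_simps)
    finally show ?thesis .
  qed
  moreover have "u * d + v * d' > 0"
    using uv d(1) d'(1) by (smt (verit) mult_nonneg_nonneg mult_pos_pos)
  ultimately show "u *\<^sub>R P + v *\<^sub>R Q \<in> spr_region a1 a2 a3 a4"
    by (auto simp: spr_region_def P Q)
qed

text \<open>Substituting \<open>X = p\<^sup>2 / a3 + 1 / a1\<close> and \<open>Y = q\<^sup>2 / a1 + a4 / a3\<close> turns the defining quadratic
into a square plus a linear term. With \<open>\<alpha> = a3 / a1\<close>, it is, for \<open>p, q > 0\<close>, positive on the half line exactly as long
as \<open>(p - q)\<^sup>2\<close> stays below \<open>- E \<alpha> / \<alpha>\<close>. On the bounding curve, where equality holds, the quadratic has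
the double root \<open>t = \<alpha> q / p\<close>, so that the curve touches the line of this slope.\<close>

lemma parabola_identity:
  assumes "a1 > 0" "a3 > 0"
  shows "odd_part a1 a3 t * ((q\<^sup>2 / a1 + a4 / a3) - t * (p\<^sup>2 / a3 + 1 / a1)) - even_part a2 a4 t
     = a1 / a3 * (p * t - a3 / a1 * q)\<^sup>2 
       + t * (- even_part a2 a4 (a3 / a1) / (a3 / a1) - (p - q)\<^sup>2)"
  using assms by (simp add: even_part_def odd_part_def field_simps power2_eq_square)

lemma parabola_point_in_spr_region:
  assumes a: "a1 > 0" "a3 > 0" and pq: "p > 0" "q > 0"
    and inside: "(p - q)\<^sup>2 < - even_part a2 a4 (a3 / a1) / (a3 / a1)"
  shows "(p\<^sup>2 / a3 + 1 / a1, q\<^sup>2 / a1 + a4 / a3) \<in> spr_region a1 a2 a3 a4"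
proof -
  define E where "E = - even_part a2 a4 (a3 / a1) / (a3 / a1) - (p - q)\<^sup>2"
  have E: "E > 0" using inside by (simp add: E_def)
  \<comment> \<open>A fraction of the square is used, so small that its negative cross term is
    absorbed by the linear term.\<close>
  define \<theta> where "\<theta> = min 1 (E / (2 * p * q))"
  have \<theta>: "0 < \<theta>" "\<theta> \<le> 1" "\<theta> * (2 * p * q) \<le> E"
    using E pq by (auto simp: \<theta>_def min_def field_simps)
  define A B where "A = a1 / a3 * p\<^sup>2" and "B = a3 / a1 * q\<^sup>2"
  have AB: "A > 0" "B > 0" using a pq by (auto simp: A_def B_def)
  have "\<theta> * min A B * (1 + t\<^sup>2) \<le> a1 / a3 * (p * t - a3 / a1 * q)\<^sup>2 + t * E" if t: "t \<ge> 0" for t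
  proof -
    have "min A B * (1 + t\<^sup>2) \<le> A * t\<^sup>2 + B"
      using mult_right_mono[of "min A B" A "t\<^sup>2"] by (simp add: algebra_simps)
    then have "\<theta> * min A B * (1 + t\<^sup>2) \<le> \<theta> * (A * t\<^sup>2 + B)"
      using \<theta>(1) by (simp add: mult.assoc)
    also have "\<dots> = \<theta> * (a1 / a3 * (p * t - a3 / a1 * q)\<^sup>2) + t * (\<theta> * (2 * p * q))"
      using a by (simp add: A_def B_def field_simps power2_eq_square)
    also have "\<dots> \<le> 1 * (a1 / a3 * (p * t - a3 / a1 * q)\<^sup>2) + t * E"
      using \<theta> a t by (intro add_mono mult_right_mono mult_left_mono) auto
    finally show ?thesis by simp
  qed
  moreover have "\<theta> * min A B > 0" using \<theta>(1) AB by simp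
  ultimately show ?thesis
    unfolding spr_region_def using parabola_identity[OF a] by (auto simp: E_def)
qed

text \<open>Along the curves \<open>q = p + d\<close> with \<open>d\<close> fixed, the point moves off in the axis direction
\<open>(1, a3 / a1)\<close>, with \<open>p\<^sup>2\<close> as leading term, and the term linear in \<open>p\<close> drifts sideways to the side given
by the sign of \<open>d\<close>. If the functional did not decrease along the axis, one of these curves would
make it unbounded.\<close>

lemma spr_region_halfplane_axis:
  assumes a: "a1 > 0" "a3 > 0" and D: "even_part a2 a4 (a3 / a1) < 0"
    and n: "(n1, n2) \<noteq> (0, 0)"
    and half: "\<And>X Y. (X, Y) \<in> spr_region a1 a2 a3 a4 \<Longrightarrow> n1 * X + n2 * Y \<le> k"
  shows "n1 + n2 * (a3 / a1) < 0"
proof (rule ccontr)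
  assume "\<not> ?thesis"
  moreover have "n1 / a3 + n2 / a1 = (n1 + n2 * (a3 / a1)) / a3"
    using a by (simp add: field_simps)
  ultimately have S: "n1 / a3 + n2 / a1 \<ge> 0" using a by simp
  define r where "r = - even_part a2 a4 (a3 / a1) / (a3 / a1)"
  have r: "r > 0" using a D by (simp add: r_def divide_neg_pos mult_neg_pos)
  define d where "d = sgn n2 * (sqrt r / 2)"
  have "d\<^sup>2 \<le> (sqrt r / 2)\<^sup>2"
    by (auto simp: d_def sgn_if)
  then have d2: "d\<^sup>2 < r" using r by (simp add: power_divide)
  have dn2: "d * n2 = \<bar>n2\<bar> * (sqrt r / 2)" by (simp add: d_def sgn_if)
  have dn: "d * n2 \<ge> 0" "n2 \<noteq> 0 \<Longrightarrow> d * n2 > 0" unfolding dn2 using r by simp_all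
  define G where "G = (n1 / a3 + n2 / a1) + 2 * (d * n2) / a1"
  have G: "G > 0"
  proof (cases "n2 = 0")
    case True
    then show ?thesis using S n a by (auto simp: G_def zero_le_divide_iff)
  next
    case False
    then show ?thesis using S dn(2) a by (simp add: G_def add_nonneg_pos)
  qed
  define C where "C = d\<^sup>2 * n2 / a1 + n1 / a1 + n2 * a4 / a3"
  have bound: "p * G + C \<le> k" if p: "p \<ge> 1" "p + d > 0" for p
  proof -
    have "(p\<^sup>2 / a3 + 1 / a1, (p + d)\<^sup>2 / a1 + a4 / a3) \<in> spr_region a1 a2 a3 a4"
      using a p d2 by (intro parabola_point_in_spr_region) (auto simp: r_def)
    from half[OF this] have "p\<^sup>2 * (n1 / a3 + n2 / a1) + p * (2 * (d * n2) / a1) + C \<le> k"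
      using a by (simp add: C_def field_simps power2_eq_square)
    moreover have "p * (n1 / a3 + n2 / a1) \<le> p\<^sup>2 * (n1 / a3 + n2 / a1)"
      using p S by (intro mult_right_mono) (auto simp: power2_eq_square)
    ultimately show ?thesis by (simp add: G_def algebra_simps)
  qed
  define p where "p = max (max 1 (1 - d)) ((k - C) / G + 1)"
  have "p \<ge> 1" "p + d > 0" "p \<ge> (k - C) / G + 1" by (auto simp: p_def)
  from bound[OF this(1,2)] this(3) G show False by (simp add: field_simps)
qed

text \<open>The region comes arbitrarily close to the point where its boundary has slope \<open>x\<close>, and there
\<open>Y - x X\<close> is the quotient of the even part by the odd part.\<close>

lemma spr_region_halfplane_tangent:
  assumes a: "a1 > 0" "a3 > 0" and D: "even_part a2 a4 (a3 / a1) < 0"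
    and x: "x > 0" "odd_part a1 a3 x \<noteq> 0" "n1 + n2 * x = 0"
    and half: "\<And>X Y. (X, Y) \<in> spr_region a1 a2 a3 a4 \<Longrightarrow> n1 * X + n2 * Y \<le> k"
  shows "n2 * (even_part a2 a4 x / odd_part a1 a3 x) \<le> k"
proof -
  define \<alpha> where "\<alpha> = a3 / a1"
  have \<alpha>: "\<alpha> > 0" using a by (simp add: \<alpha>_def)
  define r where "r = - even_part a2 a4 \<alpha> / \<alpha>"
  have r: "r > 0" using a D by (simp add: r_def \<alpha>_def divide_neg_pos mult_neg_pos)
  have "x \<noteq> \<alpha>" using x(2) a by (auto simp: odd_part_def \<alpha>_def)
  \<comment> \<open>The point of the bounding curve at which the double root is \<open>x\<close>.\<close>
  define p where "p = sqrt r / \<bar>x / \<alpha> - 1\<bar>"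
  define q where "q = p * (x / \<alpha>)"
  have p: "p > 0" using r \<open>x \<noteq> \<alpha>\<close> \<alpha> by (simp add: p_def)
  then have q: "q > 0" using x \<alpha> by (simp add: q_def)
  have "(p - q)\<^sup>2 = p\<^sup>2 * \<bar>x / \<alpha> - 1\<bar>\<^sup>2"
    by (simp add: q_def power2_eq_square algebra_simps)
  also have "\<dots> = r" using r \<open>x \<noteq> \<alpha>\<close> \<alpha> by (simp add: p_def power_divide)
  finally have pq: "(p - q)\<^sup>2 = r" .
  let ?X = "p\<^sup>2 / a3 + 1 / a1" and ?Y = "q\<^sup>2 / a1 + a4 / a3"
  define M C where "M = n1 * p\<^sup>2 / a3 + n2 * q\<^sup>2 / a1" and "C = n1 / a1 + n2 * a4 / a3"
  \<comment> \<open>Scaling \<open>p\<close> and \<open>q\<close> by \<open>sqrt s < 1\<close> moves the boundary point into the region.\<close>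
  have "s * M \<le> k - C" if s: "0 < s" "s < 1" for s
  proof -
    have "(sqrt s * p - sqrt s * q)\<^sup>2 = s * r"
      unfolding pq[symmetric] using s by (simp add: power_mult_distrib right_diff_distrib[symmetric])
    also have "\<dots> < r" using s r by simp
    finally have "((sqrt s * p)\<^sup>2 / a3 + 1 / a1, (sqrt s * q)\<^sup>2 / a1 + a4 / a3)
        \<in> spr_region a1 a2 a3 a4"
      using a p q s by (intro parabola_point_in_spr_region) (auto simp: r_def \<alpha>_def)
    from half[OF this] show ?thesis
      using s by (simp add: M_def C_def power_mult_distrib algebra_simps)
  qed
  then have "M \<le> k - C" by (rule field_le_mult_one_interval)
  moreover have "n1 * ?X + n2 * ?Y = M + C"
    by (simp add: M_def C_def algebra_simps)
  moreover have "n1 = - (n2 * x)" using x(3) by simp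
  ultimately have "n2 * (?Y - x * ?X) \<le> k" by (simp add: algebra_simps)
  moreover have "odd_part a1 a3 x * (?Y - x * ?X) - even_part a2 a4 x = 0"
    unfolding parabola_identity[OF a] using pq \<alpha> by (simp add: q_def r_def \<alpha>_def)
  then have "?Y - x * ?X = even_part a2 a4 x / odd_part a1 a3 x"
    using x(2) by (simp add: field_simps)
  ultimately show ?thesis by simp
qed

section \<open>Two regions of a stable segment meet\<close>

text \<open>A separating line would have a slope between the roots of the two odd parts. The product
\<open>n2 (E B - F A)\<close> of the second normal coordinate with the cross product of the two values is negative
at the root of the odd part \<open>A\<close> and, by the tangent bounds, nonnegative at the slope of the line. A zero in
between makes the two values antiparallel.\<close>

lemma spr_regions_meet:
  assumes a: "a1 > 0" "a3 > 0" "even_part a2 a4 (a3 / a1) < 0"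
    and b: "b1 > 0" "b3 > 0" "even_part b2 b4 (b3 / b1) < 0"
    and seg: "\<forall>t\<in>{0..1::real}. hurwitz_stable
      (smult t [:b4, b3, b2, b1, 1:] + smult (1 - t) [:a4, a3, a2, a1, 1:])"
  shows "spr_region a1 a2 a3 a4 \<inter> spr_region b1 b2 b3 b4 \<noteq> {}"
proof
  let ?R = "spr_region a1 a2 a3 a4" and ?S = "spr_region b1 b2 b3 b4"
  assume disj: "?R \<inter> ?S = {}"
  have ne: "spr_region c1 c2 c3 c4 \<noteq> {}"
    if "c1 > 0" "c3 > 0" "even_part c2 c4 (c3 / c1) < 0" for c1 c2 c3 c4
  proof -
    have "(1\<^sup>2 / c3 + 1 / c1, 1\<^sup>2 / c1 + c4 / c3) \<in> spr_region c1 c2 c3 c4"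
      using that by (intro parabola_point_in_spr_region) (auto simp: divide_neg_pos mult_neg_pos)
    then show ?thesis by auto
  qed
  obtain n k where n: "n \<noteq> 0" and R: "\<forall>x\<in>?R. inner n x \<le> k" and S: "\<forall>x\<in>?S. inner n x \<ge> k"
    using separating_hyperplane_sets[OF convex_spr_region convex_spr_region ne[OF a] ne[OF b] disj]
    by auto
  obtain n1 n2 where n12: "n = (n1, n2)" by (cases n)
  have R': "n1 * X + n2 * Y \<le> k" if "(X, Y) \<in> ?R" for X Y
    using R that by (auto simp: n12)
  have S': "(- n1) * X + (- n2) * Y \<le> - k" if "(X, Y) \<in> ?S" for X Y
    using S that by (fastforce simp: n12)
  define \<alpha> \<beta> where "\<alpha> = a3 / a1" and "\<beta> = b3 / b1"
  have pos: "\<alpha> > 0" "\<beta> > 0" using a b by (auto simp: \<alpha>_def \<beta>_def)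
  have n\<alpha>: "n1 + n2 * \<alpha> < 0"
    using spr_region_halfplane_axis[OF a _ R'] n by (auto simp: n12 zero_prod_def \<alpha>_def)
  have n\<beta>: "n1 + n2 * \<beta> > 0"
    using spr_region_halfplane_axis[OF b _ S'] n by (auto simp: n12 zero_prod_def \<beta>_def)
  have "n2 \<noteq> 0" using n\<alpha> n\<beta> by auto
  \<comment> \<open>The slope of the separating line; it lies strictly between \<open>\<alpha>\<close> and \<open>\<beta>\<close>.\<close>
  define x where "x = - n1 / n2"
  have n1: "n1 = - (n2 * x)" using \<open>n2 \<noteq> 0\<close> by (simp add: x_def)
  have x\<alpha>: "n2 * (\<alpha> - x) < 0" and x\<beta>: "n2 * (\<beta> - x) > 0"
    using n\<alpha> n\<beta> by (simp_all add: n1 algebra_simps)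
  have "x > 0"
    using x\<alpha> x\<beta> pos by (auto simp: mult_less_0_iff zero_less_mult_iff)
  have odA: "odd_part a1 a3 y = a1 * (\<alpha> - y)" and odB: "odd_part b1 b3 y = b1 * (\<beta> - y)" for y
    using a b by (simp_all add: odd_part_def \<alpha>_def \<beta>_def algebra_simps)
  let ?A = "odd_part a1 a3" and ?B = "odd_part b1 b3"
  let ?E = "even_part a2 a4" and ?F = "even_part b2 b4"
  have nA: "n2 * ?A x < 0" and nB: "n2 * ?B x > 0"
    using x\<alpha> x\<beta> a b by (simp_all add: odA odB mult.left_commute mult_pos_neg)
  then have neAB: "?A x \<noteq> 0" "?B x \<noteq> 0" by auto
  have "n2 * (?E x / ?A x) \<le> k"
    using spr_region_halfplane_tangent[OF a \<open>x > 0\<close> neAB(1) _ R'] by (simp add: n1)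
  moreover have "(- n2) * (?F x / ?B x) \<le> - k"
    using spr_region_halfplane_tangent[OF b \<open>x > 0\<close> neAB(2) _ S'] by (simp add: n1)
  ultimately have le: "n2 * (?E x / ?A x) \<le> n2 * (?F x / ?B x)" by simp
  have "(n2 * ?A x) * (n2 * ?B x) < 0" using nA nB by (simp add: mult_neg_pos)
  then have "(n2 * (?F x / ?B x)) * ((n2 * ?A x) * (n2 * ?B x)) \<le> (n2 * (?E x / ?A x)) * ((n2 * ?A x) * (n2 * ?B x))"
    using le by (intro mult_right_mono_neg) auto
  then have "n2\<^sup>2 * (n2 * (?F x * ?A x)) \<le> n2\<^sup>2 * (n2 * (?E x * ?B x))"
    using neAB by (simp add: power2_eq_square mult_ac)
  then have "n2 * (?F x * ?A x) \<le> n2 * (?E x * ?B x)"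
    by (rule mult_left_le_imp_le) (use \<open>n2 \<noteq> 0\<close> in simp)
  then have end1: "n2 * (?E x * ?B x - ?F x * ?A x) \<ge> 0"
    by (simp add: algebra_simps)
  \<comment> \<open>Moving from \<open>\<alpha>\<close> to \<open>x\<close> by a parameter in the unit interval treats \<open>\<alpha> < \<beta>\<close> and
    \<open>\<beta> < \<alpha>\<close> alike; the factor \<open>n2\<close> carries the sign of \<open>\<beta> - \<alpha>\<close>.\<close>
  define y where "y = (\<lambda>s. \<alpha> + s * (x - \<alpha>))"
  define h where "h = (\<lambda>s. n2 * (?E (y s) * ?B (y s) - ?F (y s) * ?A (y s)))"
  have \<alpha>\<beta>: "n2 * (\<beta> - \<alpha>) > 0" using x\<alpha> x\<beta> by (simp add: algebra_simps)
  have "h 0 = (b1 * (n2 * (\<beta> - \<alpha>))) * ?E \<alpha>"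
    by (simp add: h_def y_def odA odB)
  also have "\<dots> < 0" using \<alpha>\<beta> a b by (simp add: mult_pos_neg \<alpha>_def)
  finally have h0: "h 0 < 0" .
  have "h 1 \<ge> 0" using end1 by (simp add: h_def y_def)
  moreover have "continuous_on {0..1} h"
    unfolding h_def y_def even_part_def odd_part_def by (intro continuous_intros)
  ultimately obtain s where s: "0 \<le> s" "s \<le> 1" "h s = 0"
    using IVT'[of h 0 0 1] h0 by auto
  have "s \<noteq> 0" using h0 s(3) by auto
  then have "s > 0" using s by simp
  have "y s = (1 - s) * \<alpha> + s * x" by (simp add: y_def algebra_simps)
  then have "y s \<ge> 0" using s pos \<open>x > 0\<close> by simp
  have "n2 * ?A (y s) = a1 * s * (n2 * (\<alpha> - x))"
    by (simp add: odA y_def algebra_simps)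
  also have "\<dots> < 0" using a \<open>s > 0\<close> by (intro mult_pos_neg[OF _ x\<alpha>]) simp
  finally have A: "n2 * ?A (y s) < 0" .
  have "n2 * ?B (y s) = b1 * (s * (n2 * (\<beta> - x)) + (1 - s) * (n2 * (\<beta> - \<alpha>)))"
    by (simp add: odB y_def algebra_simps)
  then have B: "n2 * ?B (y s) > 0"
    using b s \<open>s > 0\<close> x\<beta> \<alpha>\<beta> by (simp add: add_pos_nonneg)
  have "?A (y s) * ?B (y s) < 0"
    using A B by (auto simp: mult_less_0_iff zero_less_mult_iff)
  from stable_segment_not_antiparallel[OF seg \<open>y s \<ge> 0\<close> this] s(3) \<open>n2 \<noteq> 0\<close>
  show False by (simp add: h_def)
qed

section \<open>Perturbation to a numerator of degree four\<close>

lemma Re_divide_pos_iff: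
  fixes z w :: complex
  shows "Re (z / w) > 0 \<longleftrightarrow> Re z * Re w + Im z * Im w > 0"
  by (cases "w = 0")
     (auto simp: Re_divide zero_less_divide_iff sum_power2_gt_zero_iff complex_eq_iff not_sum_power2_lt_zero)

text \<open>The summands \<open>e s\<^sup>4\<close> and \<open>e\<close> add \<open>e (1 + x\<^sup>2) E x\<close> to the numerator of the real part. Since
\<open>E x \<ge> a4 - a2 x\<close>, the only harmful contribution is \<open>- e a2 x (1 + x\<^sup>2)\<close>, which the margin
\<open>d x (1 + x\<^sup>2)\<close> dominates, while \<open>e a4\<close> gives positivity at \<open>x = 0\<close>.\<close>

lemma spr_region_imp_spr:
  assumes stable: "hurwitz_stable [:a4, a3, a2, a1, 1:]" and "a4 > 0"
    and d: "\<And>x. x \<ge> 0 \<Longrightarrow>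
      d * (1 + x\<^sup>2) \<le> odd_part a1 a3 x * (Y - x * X) - even_part a2 a4 x"
    and e: "e > 0" "e * a2 < d"
  shows "strictly_positive_real [:e, Y, 1, X, e:] [:a4, a3, a2, a1, 1:]"
proof -
  have "Re (ceval [:e, Y, 1, X, e:] (\<i> * of_real w) /
            ceval [:a4, a3, a2, a1, 1:] (\<i> * of_real w)) > 0" for w
  proof -
    define x where "x = w\<^sup>2"
    have x: "x \<ge> 0" "w^4 = x\<^sup>2" "w * w = x"
      by (simp_all add: x_def power4_eq_xxxx power2_eq_square)
    define f where "f = odd_part a1 a3 x * (Y - x * X) - even_part a2 a4 x"
    have "(e * x\<^sup>2 - 1 * x + e) * (1 * x\<^sup>2 - a2 * x + a4)
        + (w * (Y - X * x)) * (w * (a3 - a1 * x))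
        = x * f + e * (1 + x\<^sup>2) * (x\<^sup>2 - a2 * x + a4)"
      by (simp add: f_def odd_part_def even_part_def algebra_simps power2_eq_square flip: x(3))
    also have "\<dots> = x * (f - d * (1 + x\<^sup>2)) + (1 + x\<^sup>2) * (x * (d - e * a2) + e * (x\<^sup>2 + a4))"
      by (simp add: algebra_simps power2_eq_square)
    also have "\<dots> > 0"
    proof (rule add_nonneg_pos)
      show "0 \<le> x * (f - d * (1 + x\<^sup>2))"
        using d[OF x(1)] x(1) by (simp add: f_def)
      have "0 < x * (d - e * a2) + e * (x\<^sup>2 + a4)"
        using x(1) e \<open>a4 > 0\<close> by (intro add_nonneg_pos mult_pos_pos) (auto intro: add_nonneg_pos)
      moreover have "0 < 1 + x\<^sup>2" by (simp add: add_pos_nonneg)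
      ultimately show "0 < (1 + x\<^sup>2) * (x * (d - e * a2) + e * (x\<^sup>2 + a4))"
        by (rule mult_pos_pos[rotated])
    qed
    finally show ?thesis
      unfolding Re_divide_pos_iff ceval_imag_axis x(2) x_def[symmetric] by simp
  qed
  then show ?thesis
    using stable e by (simp add: strictly_positive_real_def)
qed

theorem theorem3:
  fixes a1 a2 a3 a4 b1 b2 b3 b4 :: real and a b :: "real poly"
  assumes "a = [:a4, a3, a2, a1, 1:]" and "b = [:b4, b3, b2, b1, 1:]"
    and "\<forall>t\<in>{0..1::real}. hurwitz_stable (smult t b + smult (1 - t) a)"
  shows "\<exists>c :: real poly. strictly_positive_real c a \<and> strictly_positive_real c b"
proof -
  have sa: "hurwitz_stable [:a4, a3, a2, a1, 1:]" and sb: "hurwitz_stable [:b4, b3, b2, b1, 1:]"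
    using bspec[OF assms(3), of 0] bspec[OF assms(3), of 1] assms(1,2) by simp_all
  note qa = hurwitz_stable_quartic[OF sa] and qb = hurwitz_stable_quartic[OF sb]
  obtain X Y where "(X, Y) \<in> spr_region a1 a2 a3 a4" "(X, Y) \<in> spr_region b1 b2 b3 b4"
    using spr_regions_meet[OF qa(1,2,4) qb(1,2,4)] assms by auto
  then obtain d d' where d: "d > 0" "\<And>x. x \<ge> 0 \<Longrightarrow>
      d * (1 + x\<^sup>2) \<le> odd_part a1 a3 x * (Y - x * X) - even_part a2 a4 x"
    and d': "d' > 0" "\<And>x. x \<ge> 0 \<Longrightarrow>
      d' * (1 + x\<^sup>2) \<le> odd_part b1 b3 x * (Y - x * X) - even_part b2 b4 x"
    by (auto simp: spr_region_def)
  define K where "K = 1 + \<bar>a2\<bar> + \<bar>b2\<bar>"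
  define e where "e = min d d' / K"
  have K: "K > 0" "a2 < K" "b2 < K" by (auto simp: K_def)
  have e: "e > 0" using d(1) d'(1) K by (simp add: e_def)
  have "e * K \<le> d" "e * K \<le> d'" using K by (simp_all add: e_def)
  moreover have "e * a2 < e * K" "e * b2 < e * K" using e K by simp_all
  ultimately have "e * a2 < d" "e * b2 < d'" by linarith+
  then show ?thesis
    using spr_region_imp_spr[OF sa qa(3) d(2) e] spr_region_imp_spr[OF sb qb(3) d'(2) e]
    unfolding assms(1,2) by blast
qed

end
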